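(* For every integer $k \ge 3$, the $k$-track $C_k \square K_2$ is containable.
   Context: Graphs are finite, simple and undirected. For an integer $k \ge 3$, the $k$-track is $C_k \square K_2$: the graph consisting of two disjoint $k$-cycles with vertices (in cyclic order) $a_0,\dots,a_{k-1}$ and $b_0,\dots,b_{k-1}$, together with an edge joining $a_j$ and $b_j$ for each $0 \le j < k$. Containment: on a connected graph $G$, $k$ cops are first placed on edges of $G$ (several cops may share an edge), then the robber chooses a vertex. They then alternate turns, cops first, with full information. On the cops' turn each cop stays put or moves to an adjacent edge (an edge sharing an endpoint with her current edge; moving through a vertex occupied by the robber is allowed). On the robber's turn he stays put or moves to an adjacent vertex along an edge not currently occupied by a cop. The cops win (contain the robber) if at some time it is the robber's turn and every edge incident with the robber's vertex is occupied by at least one cop. A connected graph $G$ is called containable if $\Delta(G)$ cops (where $\Delta(G)$ is the maximum degree) have a strategy guaranteeing a win on $G$, and uncontainable otherwise. *)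

theory Defs
  imports Main
begin

section \<open>Finite simple undirected graphs\<close>

record 'a ugraph =
  verts :: "'a set"
  edges :: "'a set set"

definition simple_graph :: "'a ugraph \<Rightarrow> bool" where
  "simple_graph G \<longleftrightarrow> finite (verts G) \<and>
     (\<forall>e\<in>edges G. \<exists>u v. u \<in> verts G \<and> v \<in> verts G \<and> u \<noteq> v \<and> e = {u, v})"

text \<open>The graph without vertices is not counted as connected.\<close>

definition connected_graph :: "'a ugraph \<Rightarrow> bool" where
  "connected_graph G \<longleftrightarrow> verts G \<noteq> {} \<and>
     (\<forall>u\<in>verts G. \<forall>v\<in>verts G. (u, v) \<in> {(x, y). {x, y} \<in> edges G}\<^sup>*)"

definition incident_edges :: "'a ugraph \<Rightarrow> 'a \<Rightarrow> 'a set set" where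
  "incident_edges G v = {e \<in> edges G. v \<in> e}"

definition degree :: "'a ugraph \<Rightarrow> 'a \<Rightarrow> nat" where
  "degree G v = card (incident_edges G v)"

definition max_degree :: "'a ugraph \<Rightarrow> nat" where
  "max_degree G = Max (degree G ` verts G)"

definition cartesian_product :: "'a ugraph \<Rightarrow> 'b ugraph \<Rightarrow> ('a \<times> 'b) ugraph" where
  "cartesian_product G H = \<lparr>
     verts = verts G \<times> verts H,
     edges = {{(u, x), (v, y)} | u v x y.
                (u = v \<and> u \<in> verts G \<and> {x, y} \<in> edges H) \<or>
                (x = y \<and> x \<in> verts H \<and> {u, v} \<in> edges G)}\<rparr>"

text \<open>This is the \<open>k\<close>-cycle only for \<open>k \<ge> 3\<close>.\<close>

definition cycle_graph :: "nat \<Rightarrow> nat ugraph" where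
  "cycle_graph k = \<lparr>verts = {..<k}, edges = (\<lambda>i. {i, Suc i mod k}) ` {..<k}\<rparr>"

definition complete_graph :: "nat \<Rightarrow> nat ugraph" where
  "complete_graph n = \<lparr>verts = {..<n}, edges = {{i, j} | i j. i < n \<and> j < n \<and> i \<noteq> j}\<rparr>"

text \<open>The vertices \<open>a\<^sub>j\<close> and \<open>b\<^sub>j\<close> are the pairs \<open>(j, 0)\<close> and \<open>(j, 1)\<close>.\<close>

definition track :: "nat \<Rightarrow> (nat \<times> nat) ugraph" where
  "track k = cartesian_product (cycle_graph k) (complete_graph 2)"


section \<open>The game of Containment\<close>

text \<open>A position of \<open>m\<close> cops is a function \<open>c\<close> whose values at \<open>i < m\<close> are the edges they
  occupy; it need not be injective, and its values at \<open>i \<ge> m\<close> are irrelevant.\<close>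

definition occupied :: "nat \<Rightarrow> (nat \<Rightarrow> 'a set) \<Rightarrow> 'a set set" where
  "occupied m c = c ` {..<m}"

definition cop_placement :: "'a ugraph \<Rightarrow> nat \<Rightarrow> (nat \<Rightarrow> 'a set) \<Rightarrow> bool" where
  "cop_placement G m c \<longleftrightarrow> (\<forall>i<m. c i \<in> edges G)"

definition adjacent_edges :: "'a ugraph \<Rightarrow> 'a set \<Rightarrow> 'a set \<Rightarrow> bool" where
  "adjacent_edges G e f \<longleftrightarrow> e \<in> edges G \<and> f \<in> edges G \<and> e \<noteq> f \<and> e \<inter> f \<noteq> {}"

definition cop_move :: "'a ugraph \<Rightarrow> nat \<Rightarrow> (nat \<Rightarrow> 'a set) \<Rightarrow> (nat \<Rightarrow> 'a set) \<Rightarrow> bool" where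
  "cop_move G m c c' \<longleftrightarrow> (\<forall>i<m. c' i = c i \<or> adjacent_edges G (c i) (c' i))"

definition robber_move :: "'a ugraph \<Rightarrow> nat \<Rightarrow> (nat \<Rightarrow> 'a set) \<Rightarrow> 'a \<Rightarrow> 'a \<Rightarrow> bool" where
  "robber_move G m c v v' \<longleftrightarrow>
     v' = v \<or> ({v, v'} \<in> edges G \<and> {v, v'} \<notin> occupied m c)"

definition contained :: "'a ugraph \<Rightarrow> nat \<Rightarrow> (nat \<Rightarrow> 'a set) \<Rightarrow> 'a \<Rightarrow> bool" where
  "contained G m c v \<longleftrightarrow> incident_edges G v \<subseteq> occupied m c"

text \<open>A strategy \<open>\<sigma>\<close> for the cops maps the list of all robber positions seen so far, oldest first,
  to the position the cops take: \<open>\<sigma> []\<close> is the initial placement, made before the robber appears,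
  and \<open>\<sigma> [r\<^sub>0, \<dots>, r\<^sub>n]\<close> is their position after their turn number \<open>n + 1\<close>. The earlier
  cop positions are determined by \<open>\<sigma>\<close>, so this is the full history of the game.\<close>

type_synonym 'a cop_strategy = "'a list \<Rightarrow> nat \<Rightarrow> 'a set"

definition legal_strategy :: "'a ugraph \<Rightarrow> nat \<Rightarrow> 'a cop_strategy \<Rightarrow> bool" where
  "legal_strategy G m \<sigma> \<longleftrightarrow> cop_placement G m (\<sigma> []) \<and>
     (\<forall>h v. set h \<subseteq> verts G \<and> v \<in> verts G \<longrightarrow> cop_move G m (\<sigma> h) (\<sigma> (h @ [v])))"

text \<open>The position of the cops against a robber sequence \<open>r\<close>, after they have seen
  \<open>r 0, \<dots>, r (n - 1)\<close>.\<close>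

definition cops_at :: "'a cop_strategy \<Rightarrow> (nat \<Rightarrow> 'a) \<Rightarrow> nat \<Rightarrow> nat \<Rightarrow> 'a set" where
  "cops_at \<sigma> r n = \<sigma> (map r [0..<n])"

text \<open>The robber chooses \<open>r 0\<close> at the start. When the robber is at \<open>r n\<close>, the cops move
  to \<open>cops_at \<sigma> r (Suc n)\<close>, and then it is the robber's turn.
  Since the robber may always stay put, every play can be continued forever.\<close>

definition robber_play :: "'a ugraph \<Rightarrow> nat \<Rightarrow> 'a cop_strategy \<Rightarrow> (nat \<Rightarrow> 'a) \<Rightarrow> bool" where
  "robber_play G m \<sigma> r \<longleftrightarrow> r 0 \<in> verts G \<and>
     (\<forall>n. robber_move G m (cops_at \<sigma> r (Suc n)) (r n) (r (Suc n)))"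

definition winning_strategy :: "'a ugraph \<Rightarrow> nat \<Rightarrow> 'a cop_strategy \<Rightarrow> bool" where
  "winning_strategy G m \<sigma> \<longleftrightarrow> legal_strategy G m \<sigma> \<and>
     (\<forall>r. robber_play G m \<sigma> r \<longrightarrow> (\<exists>n. contained G m (cops_at \<sigma> r (Suc n)) (r n)))"

definition containable :: "'a ugraph \<Rightarrow> bool" where
  "containable G \<longleftrightarrow> simple_graph G \<and> connected_graph G \<and>
     (\<exists>\<sigma>. winning_strategy G (max_degree G) \<sigma>)"


section \<open>Explicit description of the track\<close>

lemma verts_track: "verts (track k) = {..<k} \<times> {0, 1}"
  by (auto simp: track_def cartesian_product_def cycle_graph_def complete_graph_def)

lemma edges_track:
  "edges (track k) =
     (\<lambda>j. {(j, 0), (Suc j mod k, 0)}) ` {..<k} \<union>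
     (\<lambda>j. {(j, 1), (Suc j mod k, 1)}) ` {..<k} \<union>
     (\<lambda>j. {(j, 0), (j, 1)}) ` {..<k}"
  (is "_ = ?A \<union> ?B \<union> ?C")
proof -
  have K2: "{x, y} \<in> edges (complete_graph 2) \<longleftrightarrow> {x, y} = {0, 1}" for x y :: nat
    by (auto simp: complete_graph_def doubleton_eq_iff less_2_cases_iff)
  have Ck: "{u, v} \<in> edges (cycle_graph k) \<longleftrightarrow> (\<exists>i<k. {u, v} = {i, Suc i mod k})" for u v
    by (auto simp: cycle_graph_def)
  have T: "e \<in> edges (track k) \<longleftrightarrow> (\<exists>u v x y. e = {(u, x), (v, y)} \<and>
      ((u = v \<and> u < k \<and> {x, y} = {0, 1}) \<or>
       (x = y \<and> x < 2 \<and> (\<exists>i<k. {u, v} = {i, Suc i mod k}))))" for e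
    by (simp add: track_def cartesian_product_def K2 Ck)
       (simp add: cycle_graph_def complete_graph_def)
  show ?thesis
  proof (intro subset_antisym subsetI)
    fix e assume "e \<in> edges (track k)"
    then obtain u v x y where e: "e = {(u, x), (v, y)}"
      and *: "(u = v \<and> u < k \<and> {x, y} = {0, 1}) \<or>
        (x = y \<and> x < 2 \<and> (\<exists>i<k. {u, v} = {i, Suc i mod k}))"
      unfolding T by blast
    from * show "e \<in> ?A \<union> ?B \<union> ?C"
    proof (elim disjE conjE exE)
      assume "u = v" "u < k" "{x, y} = {0, 1}"
      then have "e = {(u, 0), (u, 1)}" using e by (auto simp: doubleton_eq_iff)
      with \<open>u < k\<close> show ?thesis by blast
    next
      fix i assume "x = y" "x < 2" "i < k" "{u, v} = {i, Suc i mod k}"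
      then have "e = {(i, x), (Suc i mod k, x)}"
        using e by (auto simp: doubleton_eq_iff)
      moreover have "x = 0 \<or> x = 1" using \<open>x < 2\<close> by auto
      ultimately show ?thesis using \<open>i < k\<close> by blast
    qed
  next
    fix e assume "e \<in> ?A \<union> ?B \<union> ?C"
    then consider j x where "j < k" "x < 2" "e = {(j, x), (Suc j mod k, x)}"
      | j where "j < k" "e = {(j, 0), (j, 1)}"
      by (smt (verit, best) Un_iff imageE lessThan_iff one_less_numeral_iff semiring_norm(76)
          zero_less_numeral)
    then show "e \<in> edges (track k)"
    proof cases
      case 1 then show ?thesis unfolding T by blast
    next
      case 2 then show ?thesis unfolding T by blast
    qed
  qed
qed

end

theory Submission
  imports Defs
begin

text \<open>Two cops sweep around the track until one of them touches the robber's column; she then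
  shadows him. If he is on her rung she can, whenever he moves along a row, step onto the edge
  behind him, and return to his rung as soon as he stops or changes rows. While she does so, the
  other two cops close in from the left and from the right, and the gap between them shrinks until
  the three cops occupy the rungs of the robber's column and of both neighbouring columns. From
  there he is contained after a few more moves.\<close>

section \<open>Winning positions\<close>

text \<open>The cops are to move and the robber is at \<open>v\<close>. As a least fixed point the
  predicate admits only well-founded play: every line ends in containment, with no bound on its
  length fixed in advance.\<close>

inductive cops_win :: "'a ugraph \<Rightarrow> nat \<Rightarrow> (nat \<Rightarrow> 'a set) \<Rightarrow> 'a \<Rightarrow> bool"
  for G :: "'a ugraph" and m :: nat where
  cops_win_contained:
    "\<lbrakk>cop_move G m c c'; contained G m c' v\<rbrakk> \<Longrightarrow> cops_win G m c v"
| cops_win_move: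
    "\<lbrakk>cop_move G m c c'; \<And>v'. robber_move G m c' v v' \<Longrightarrow> cops_win G m c' v'\<rbrakk>
     \<Longrightarrow> cops_win G m c v"

section \<open>From inductively won positions to strategies\<close>

lemma cop_move_refl [simp]: "cop_move G m c c"
  by (simp add: cop_move_def)

text \<open>The game resumed at cops \<open>c\<close> and robber \<open>v\<close>. Legality is
  demanded on all histories, even those that leave the graph, so that strategies can be glued
  without side conditions on vertices.\<close>

definition wins_from ::
  "'a ugraph \<Rightarrow> nat \<Rightarrow> 'a cop_strategy \<Rightarrow> (nat \<Rightarrow> 'a set) \<Rightarrow> 'a \<Rightarrow> bool" where
  "wins_from G m \<sigma> c v \<longleftrightarrow> \<sigma> [] = c \<and> (\<forall>h u. cop_move G m (\<sigma> h) (\<sigma> (h @ [u]))) \<and>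
     (\<forall>r. r 0 = v \<longrightarrow> (\<forall>n. robber_move G m (cops_at \<sigma> r (Suc n)) (r n) (r (Suc n))) \<longrightarrow>
        (\<exists>n. contained G m (cops_at \<sigma> r (Suc n)) (r n)))"

lemma wins_from_Nil: "wins_from G m \<sigma> c v \<Longrightarrow> \<sigma> [] = c"
  and wins_from_legal: "wins_from G m \<sigma> c v \<Longrightarrow> cop_move G m (\<sigma> h) (\<sigma> (h @ [u]))"
  and wins_from_wins: "\<lbrakk>wins_from G m \<sigma> c v; r 0 = v;
      \<And>n. robber_move G m (cops_at \<sigma> r (Suc n)) (r n) (r (Suc n))\<rbrakk>
    \<Longrightarrow> \<exists>n. contained G m (cops_at \<sigma> r (Suc n)) (r n)"
  by (simp_all add: wins_from_def)

lemma map_upt_Suc_comp: "map r [0..<Suc n] = r 0 # map (\<lambda>i. r (Suc i)) [0..<n]"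
  by (simp add: upt_conv_Cons map_Suc_upt[symmetric] comp_def del: upt_Suc)

text \<open>Induction on the win: play the move to \<open>c'\<close>, then follow a strategy chosen
  for the robber's reply.\<close>

lemma wins_from_if_cops_win:
  assumes "cops_win G m c v"
  shows "\<exists>\<sigma>. wins_from G m \<sigma> c v"
  using assms
proof induction
  case (cops_win_contained c c' v)
  let ?s = "\<lambda>h. if h = [] then c else c'"
  have "wins_from G m ?s c v"
    unfolding wins_from_def
  proof (intro conjI allI impI)
    fix r :: "nat \<Rightarrow> 'a" assume "r 0 = v"
    then have "contained G m (cops_at ?s r (Suc 0)) (r 0)"
      using cops_win_contained by (simp add: cops_at_def)
    then show "\<exists>n. contained G m (cops_at ?s r (Suc n)) (r n)" by blast
  qed (use cops_win_contained in auto)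
  then show ?case by blast
next
  case (cops_win_move c c' v)
  then obtain S where S: "\<And>w. robber_move G m c' v w \<Longrightarrow> wins_from G m (S w) c' w"
    by metis
  \<comment> \<open>The first entry is the known position \<open>v\<close>, so the second one
    selects the strategy, whose own history starts there. An impossible reply gets the default
    \<open>c'\<close>: standing still is always legal.\<close>
  let ?s = "\<lambda>h. case h of [] \<Rightarrow> c | [u] \<Rightarrow> c' | u # w # h' \<Rightarrow>
     if robber_move G m c' v w then S w (w # h') else c'"
  have legal: "cop_move G m (?s h) (?s (h @ [u]))" for h u
  proof (cases h)
    case Nil
    then show ?thesis using cops_win_move by simp
  next
    case (Cons a t)
    show ?thesis
    proof (cases t)
      case Nil
      then show ?thesis
        using Cons wins_from_Nil[OF S] wins_from_legal[OF S, of u "[]" u] by auto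
    next
      case (Cons w t')
      then show ?thesis
        using \<open>h = a # t\<close> wins_from_legal[OF S, of w "w # t'" u] by auto
    qed
  qed
  have "wins_from G m ?s c v"
    unfolding wins_from_def
  proof (intro conjI allI impI)
    show "?s [] = c" by simp
    show "cop_move G m (?s h) (?s (h @ [u]))" for h u by (rule legal)
    fix r :: "nat \<Rightarrow> 'a"
    assume r0: "r 0 = v"
      and play: "\<forall>n. robber_move G m (cops_at ?s r (Suc n)) (r n) (r (Suc n))"
    have "cops_at ?s r (Suc 0) = c'" by (simp add: cops_at_def)
    then have move: "robber_move G m c' v (r (Suc 0))" using play[rule_format, of 0] r0 by simp
    let ?r = "\<lambda>i. r (Suc i)"
    have eq: "cops_at (S (r (Suc 0))) ?r (Suc n) = cops_at ?s r (Suc (Suc n))" for n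
      unfolding cops_at_def map_upt_Suc_comp[of _ "Suc n"] map_upt_Suc_comp[of _ n]
      using move by simp
    have "\<exists>n. contained G m (cops_at (S (r (Suc 0))) ?r (Suc n)) (?r n)"
      using play by (intro wins_from_wins[OF S[OF move]]) (simp_all add: eq)
    then show "\<exists>n. contained G m (cops_at ?s r (Suc n)) (r n)"
      unfolding eq by blast
  qed
  then show ?case by blast
qed

lemma winning_strategy_if_cops_win:
  assumes c: "cop_placement G m c"
    and win: "\<And>v. v \<in> verts G \<Longrightarrow> cops_win G m c v"
  shows "\<exists>\<sigma>. winning_strategy G m \<sigma>"
proof -
  obtain S where S: "\<And>v. v \<in> verts G \<Longrightarrow> wins_from G m (S v) c v"
    using wins_from_if_cops_win[OF win] by metis
  \<comment> \<open>Here the first entry is the robber's free choice; it selects the strategy, which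
    receives the whole history.\<close>
  let ?s = "\<lambda>h. case h of [] \<Rightarrow> c | v # h' \<Rightarrow> S v h"
  have "winning_strategy G m ?s"
    unfolding winning_strategy_def legal_strategy_def
  proof (intro conjI allI impI)
    fix h v assume "set h \<subseteq> verts G \<and> v \<in> verts G"
    then show "cop_move G m (?s h) (?s (h @ [v]))"
      using wins_from_Nil[OF S, of v] wins_from_legal[OF S, of v "[]" v]
        wins_from_legal[OF S, of "hd h" h v]
      by (cases h) auto
  next
    fix r assume play: "robber_play G m ?s r"
    then have "r 0 \<in> verts G" by (simp add: robber_play_def)
    moreover have eq: "cops_at (S (r 0)) r (Suc n) = cops_at ?s r (Suc n)" for n
      unfolding cops_at_def map_upt_Suc_comp by simp
    ultimately have "\<exists>n. contained G m (cops_at (S (r 0)) r (Suc n)) (r n)"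
      using play by (intro wins_from_wins[OF S]) (simp_all add: eq robber_play_def)
    then show "\<exists>n. contained G m (cops_at ?s r (Suc n)) (r n)"
      unfolding eq .
  qed (use c in simp)
  then show ?thesis by blast
qed

text \<open>Cops are interchangeable: containment and robber moves depend only on the set of
  occupied edges.\<close>

lemma cops_win_permute:
  assumes "cops_win G m c v" and p: "bij_betw p {..<m} {..<m}"
  shows "cops_win G m (c \<circ> p) v"
  using assms(1)
proof induction
  have occ: "occupied m (c \<circ> p) = occupied m c" for c :: "nat \<Rightarrow> 'a set"
    using bij_betw_imp_surj_on[OF p] by (simp only: occupied_def image_comp[symmetric])
  have move: "cop_move G m (c \<circ> p) (c' \<circ> p)" if "cop_move G m c c'" for c c'
    using that bij_betw_apply[OF p] by (simp add: cop_move_def)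
  {
    case (cops_win_contained c c' v)
    show ?case
      by (rule cops_win.cops_win_contained[OF move[OF cops_win_contained.hyps(1)]])
        (use cops_win_contained.hyps in \<open>simp add: contained_def occ\<close>)
  next
    case (cops_win_move c c' v)
    show ?case
    proof (rule cops_win.cops_win_move[OF move[OF cops_win_move.hyps(1)]])
      fix v' assume "robber_move G m (c' \<circ> p) v v'"
      then show "cops_win G m (c' \<circ> p) v'"
        by (intro cops_win_move.IH) (simp add: robber_move_def occ)
    qed
  }
qed


section \<open>Coordinates on the track\<close>

locale track_coordinates =
  fixes k :: nat
  assumes k3: "k \<ge> 3"
begin

text \<open>Columns are integers modulo \<open>k\<close>; the flag \<open>d\<close> is the orientation in which they are
  counted, so that a mirrored position is the same position read with \<open>\<not> d\<close>.\<close>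

definition vx :: "bool \<Rightarrow> int \<Rightarrow> bool \<Rightarrow> nat \<times> nat" where
  "vx d i x = (nat ((if d then i else - i) mod int k), of_bool x)"

definition row :: "bool \<Rightarrow> bool \<Rightarrow> int \<Rightarrow> (nat \<times> nat) set" where
  "row d x i = {vx d i x, vx d (i + 1) x}"

definition rung :: "bool \<Rightarrow> int \<Rightarrow> (nat \<times> nat) set" where
  "rung d i = {vx d i False, vx d i True}"

lemma vx_flip: "vx (\<not> d) i x = vx d (- i) x"
  by (simp add: vx_def)

lemma row_flip: "row (\<not> d) x i = row d x (- i - 1)"
  by (auto simp: row_def vx_flip)

lemma rung_flip: "rung (\<not> d) i = rung d (- i)"
  by (simp add: rung_def vx_flip)

lemma vx_period: "vx d (i + int k * t) x = vx d i x"
proof -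
  have "(- i - int k * t) mod int k = - i mod int k"
    using mod_mult_self2[of "- i" "int k" "- t"] by simp
  then show ?thesis by (simp add: vx_def)
qed

lemma row_period: "row d x (i + int k * t) = row d x i"
  using vx_period[of d i t x] vx_period[of d "i + 1" t x]
  by (simp add: row_def algebra_simps)

lemma verts_vx: "v \<in> verts (track k) \<longleftrightarrow> (\<exists>i x. 0 \<le> i \<and> i < int k \<and> v = vx True i x)"
proof
  assume "v \<in> verts (track k)"
  then obtain j y where v: "v = (j, y)" "j < k" "y = 0 \<or> y = 1" by (auto simp: verts_track)
  then have "v = vx True (int j) (y = 1)" by (auto simp: vx_def)
  with v(2) show "\<exists>i x. 0 \<le> i \<and> i < int k \<and> v = vx True i x"
    by (intro exI[of _ "int j"]) auto
next
  assume "\<exists>i x. 0 \<le> i \<and> i < int k \<and> v = vx True i x"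
  then show "v \<in> verts (track k)" by (auto simp: verts_track vx_def)
qed

lemma vx_True_Suc: "vx True (int j + 1) x = (Suc j mod k, of_bool x)"
  by (simp add: vx_def nat_mod_as_int add.commute)

lemma edges_coord:
  "e \<in> edges (track k) \<longleftrightarrow> (\<exists>x i. e = row True x i) \<or> (\<exists>i. e = rung True i)"
proof
  assume "e \<in> edges (track k)"
  then consider j where "j < k" "e = row True False (int j)" | j where "j < k" "e = row True True (int j)"
    | j where "j < k" "e = rung True (int j)"
    unfolding edges_track row_def rung_def vx_True_Suc by (auto simp: vx_def)
  then show "(\<exists>x i. e = row True x i) \<or> (\<exists>i. e = rung True i)"
    by cases blast+
next
  have row: "row True x (int j) \<in> edges (track k)" if "j < k" for x j
    using that unfolding edges_track row_def rung_def vx_True_Suc by (cases x) (auto simp: vx_def)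
  have rung: "rung True (int j) \<in> edges (track k)" if "j < k" for j
    using that unfolding edges_track row_def rung_def vx_True_Suc by (auto simp: vx_def)
  \<comment> \<open>Every column index reduces modulo \<open>k\<close> to one in the range used by
    \<open>edges_track\<close>.\<close>
  have red: "\<exists>j t. j < k \<and> i = int j + int k * t" for i
    using k3 by (intro exI[of _ "nat (i mod int k)"] exI[of _ "i div int k"])
      (auto simp: nat_less_iff)
  assume "(\<exists>x i. e = row True x i) \<or> (\<exists>i. e = rung True i)"
  then show "e \<in> edges (track k)"
  proof (elim disjE exE)
    fix x i assume "e = row True x i"
    with red[of i] row show ?thesis by (metis row_period)
  next
    fix i assume "e = rung True i"
    with red[of i] rung show ?thesis by (metis rung_def vx_period)
  qed
qed

lemma row_edge [simp]: "row d x i \<in> edges (track k)"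
  using edges_coord row_flip[of True x i] by (cases d) auto

lemma rung_edge [simp]: "rung d i \<in> edges (track k)"
  using edges_coord rung_flip[of True i] by (cases d) auto

lemma vx_eq_iff: "vx d i x = vx d j y \<longleftrightarrow> int k dvd i - j \<and> x = y"
proof -
  have "nat (a mod int k) = nat (b mod int k) \<longleftrightarrow> int k dvd a - b" for a b
    using k3 by (simp add: eq_nat_nat_iff mod_eq_dvd_iff)
  then show ?thesis
    by (cases d) (auto simp: vx_def dvd_diff_commute)
qed

lemma vx_eqE:
  assumes "vx d i x = vx d j y"
  obtains t where "i = j + int k * t" "x = y"
  using assms unfolding vx_eq_iff by (metis add.commute diff_add_cancel dvdE)

lemma incident_edges_vx:
  "incident_edges (track k) (vx d j x) = {row d x (j - 1), row d x j, rung d j}"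
proof -
  have True: "incident_edges (track k) (vx True j x) = {row True x (j - 1), row True x j, rung True j}" for j
  proof (intro subset_antisym subsetI)
    fix e assume "e \<in> incident_edges (track k) (vx True j x)"
    then have v: "vx True j x \<in> e" and "(\<exists>y i. e = row True y i) \<or> (\<exists>i. e = rung True i)"
      by (auto simp: incident_edges_def edges_coord)
    then show "e \<in> {row True x (j - 1), row True x j, rung True j}"
    proof (elim disjE exE)
      fix y i assume e: "e = row True y i"
      with v consider "vx True j x = vx True i y" | "vx True j x = vx True (i + 1) y"
        by (auto simp: row_def)
      then show ?thesis
      proof cases
        case 1
        then show ?thesis by (elim vx_eqE) (simp add: e row_period)
      next
        case 2
        then obtain t where "j = i + 1 + int k * t" "x = y" by (rule vx_eqE)
        then have "row True x (j - 1) = e" using row_period[of True y i t] by (simp add: e)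
        then show ?thesis by simp
      qed
    next
      fix i assume e: "e = rung True i"
      with v obtain y where "vx True j x = vx True i y" by (auto simp: rung_def)
      then have "rung True j = e"
        by (elim vx_eqE) (simp add: e rung_def vx_period)
      then show ?thesis by simp
    qed
  next
    fix e assume "e \<in> {row True x (j - 1), row True x j, rung True j}"
    then show "e \<in> incident_edges (track k) (vx True j x)"
      using row_edge rung_edge
      by (cases x) (auto simp: incident_edges_def, auto simp: row_def rung_def)
  qed
  \<comment> \<open>Reversing the orientation exchanges the two row edges and keeps the
    rung.\<close>
  show ?thesis
    using True[of j] True[of "- j"] vx_flip[of True j x] row_flip[of True x j]
      row_flip[of True x "j - 1"] rung_flip[of True j]
    by (cases d) (auto simp: algebra_simps)
qed

section \<open>Degree, simplicity and connectedness of the track\<close>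

lemma degree_vx: "degree (track k) (vx d j x) = 3"
proof -
  \<comment> \<open>Two of these edges could coincide only if column numbers differing by 1 or 2
    agreed modulo \<open>k\<close>, which \<open>k \<ge> 3\<close> excludes.\<close>
  have small: "\<not> int k dvd n" if "0 < \<bar>n\<bar>" "\<bar>n\<bar> \<le> 2" for n
    using that k3 dvd_imp_le_int[of n "int k"] by auto
  have "row d x (j - 1) \<noteq> row d x j" "row d x (j - 1) \<noteq> rung d j" "row d x j \<noteq> rung d j"
    using small[of 1] small[of 2] small[of "-1"] small[of "-2"]
    by (auto simp: row_def rung_def doubleton_eq_iff vx_eq_iff)
  then show ?thesis
    by (simp add: degree_def incident_edges_vx)
qed

lemma max_degree_track: "max_degree (track k) = 3"
proof -
  have "verts (track k) \<noteq> {}" using k3 by (auto simp: verts_track lessThan_empty_iff)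
  moreover have "degree (track k) v = 3" if "v \<in> verts (track k)" for v
    using that by (auto simp: verts_vx degree_vx)
  ultimately have "degree (track k) ` verts (track k) = {3}" by auto
  then show ?thesis by (simp add: max_degree_def)
qed

lemma simple_graph_track: "simple_graph (track k)"
proof -
  have "\<not> int k dvd -1" "\<not> int k dvd 1" using k3 by auto
  moreover have "vx True i x \<in> verts (track k)" for i x
    using k3 by (auto simp: verts_track vx_def nat_less_iff)
  ultimately have "\<exists>u v. u \<in> verts (track k) \<and> v \<in> verts (track k) \<and> u \<noteq> v \<and> e = {u, v}"
    if "e \<in> edges (track k)" for e
    using that unfolding edges_coord row_def rung_def
    by (elim disjE exE; intro exI conjI; assumption?) (auto simp: vx_eq_iff)
  then show ?thesis
    by (auto simp: simple_graph_def verts_track)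
qed

lemma connected_graph_track: "connected_graph (track k)"
proof -
  let ?E = "{(x, y). {x, y} \<in> edges (track k)}"
  have "sym ?E" by (auto simp: sym_def insert_commute)
  have rows: "(vx True 0 x, vx True (int n) x) \<in> ?E\<^sup>*" for n x
  proof (induction n)
    case (Suc n)
    have "(vx True (int n) x, vx True (int (Suc n)) x) \<in> ?E"
      using row_edge[of True x "int n"] by (simp add: row_def add.commute)
    with Suc show ?case by (rule rtrancl_into_rtrancl)
  qed simp
  have "(vx True 0 False, vx True 0 True) \<in> ?E\<^sup>*"
    using rung_edge[of True 0] by (auto simp: rung_def)
  then have start: "(vx True 0 False, vx True 0 x) \<in> ?E\<^sup>*" for x by (cases x) auto
  then have from0: "(vx True 0 False, v) \<in> ?E\<^sup>*" if "v \<in> verts (track k)" for v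
  proof -
    from that obtain i x where "0 \<le> i" "v = vx True i x" by (auto simp: verts_vx)
    then have "v = vx True (int (nat i)) x" by simp
    then show ?thesis using rtrancl_trans[OF start[of x] rows[of x "nat i"]] by (simp only:)
  qed
  have "(u, v) \<in> ?E\<^sup>*" if "u \<in> verts (track k)" "v \<in> verts (track k)" for u v
    using symD[OF sym_rtrancl[OF \<open>sym ?E\<close>] from0[OF that(1)]] from0[OF that(2)]
    by (rule rtrancl_trans)
  moreover have "verts (track k) \<noteq> {}" using k3 by (auto simp: verts_track lessThan_empty_iff)
  ultimately show ?thesis by (auto simp: connected_graph_def)
qed


section \<open>Three cops on the track\<close>

definition tri :: "'b \<Rightarrow> 'b \<Rightarrow> 'b \<Rightarrow> nat \<Rightarrow> 'b" where
  "tri p q r i = (if i = 0 then p else if i = 1 then q else r)"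

text \<open>Winning positions with the cops, respectively the robber, to move.\<close>

definition cw :: "(nat \<times> nat) set \<Rightarrow> (nat \<times> nat) set \<Rightarrow> (nat \<times> nat) set \<Rightarrow> nat \<times> nat \<Rightarrow> bool" where
  "cw p q r v \<longleftrightarrow> cops_win (track k) 3 (tri p q r) v"

definition rw :: "(nat \<times> nat) set \<Rightarrow> (nat \<times> nat) set \<Rightarrow> (nat \<times> nat) set \<Rightarrow> nat \<times> nat \<Rightarrow> bool" where
  "rw p q r v \<longleftrightarrow> contained (track k) 3 (tri p q r) v \<or>
     (\<forall>v'. robber_move (track k) 3 (tri p q r) v v' \<longrightarrow> cw p q r v')"

text \<open>Adjacency made reflexive, so that one condition covers both moving and staying
  put.\<close>

definition near :: "(nat \<times> nat) set \<Rightarrow> (nat \<times> nat) set \<Rightarrow> bool" where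
  "near e f \<longleftrightarrow> e \<in> edges (track k) \<and> f \<in> edges (track k) \<and> e \<inter> f \<noteq> {}"

lemma all_less_3: "(\<forall>i<3::nat. P i) \<longleftrightarrow> P 0 \<and> P 1 \<and> P 2"
  by (auto simp: numeral_eq_Suc less_Suc_eq)

lemma occupied_tri: "occupied 3 (tri p q r) = {p, q, r}"
proof -
  have "{..<3::nat} = {0, 1, 2}" by auto
  then show ?thesis by (simp add: occupied_def tri_def insert_commute)
qed

lemma cwI:
  assumes "near p p'" "near q q'" "near r r'" "rw p' q' r' v"
  shows "cw p q r v"
proof -
  have move: "cop_move (track k) 3 (tri p q r) (tri p' q' r')"
    using assms(1-3) by (auto simp: cop_move_def all_less_3 tri_def adjacent_edges_def near_def)
  show ?thesis
    using assms(4) cops_win_contained[OF move] cops_win_move[OF move]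
    unfolding rw_def cw_def by blast
qed

lemma cw_permute:
  assumes "cw p q r v" "bij_betw f {..<3} {..<3}"
    and "tri p q r \<circ> f = tri p' q' r'"
  shows "cw p' q' r' v"
  using cops_win_permute[OF assms(1)[unfolded cw_def] assms(2)] assms(3) by (simp add: cw_def)

text \<open>Mirroring a position exchanges the left and the right cop; this restores their
  order.\<close>

lemma cw_swap_outer: "cw p q r v \<Longrightarrow> cw r q p v"
proof (erule cw_permute[where f = "\<lambda>i::nat. if i = 0 then 2 else if i = 1 then 1 else 0::nat"])
  show "bij_betw (\<lambda>i::nat. if i = 0 then 2 else if i = 1 then 1 else 0::nat) {..<3} {..<3::nat}"
    by (rule bij_betw_byWitness[where f' = "\<lambda>i::nat. if i = 0 then 2 else if i = 1 then 1 else 0::nat"])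
      (auto simp: less_Suc_eq numeral_eq_Suc)
qed (simp add: tri_def fun_eq_iff)

lemma cw_swap_last: "cw p q r v \<Longrightarrow> cw p r q v"
proof (erule cw_permute[where f = "\<lambda>i::nat. if i = 0 then 0 else if i = 1 then 2 else 1::nat"])
  show "bij_betw (\<lambda>i::nat. if i = 0 then 0 else if i = 1 then 2 else 1::nat) {..<3} {..<3::nat}"
    by (rule bij_betw_byWitness[where f' = "\<lambda>i::nat. if i = 0 then 0 else if i = 1 then 2 else 1::nat"])
      (auto simp: less_Suc_eq numeral_eq_Suc)
qed (simp add: tri_def fun_eq_iff)

lemma rw_containedI:
  "{row d x (j - 1), row d x j, rung d j} \<subseteq> {p, q, r} \<Longrightarrow> rw p q r (vx d j x)"
  by (simp add: rw_def contained_def incident_edges_vx occupied_tri)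

text \<open>A vertex has just three incident edges, so these four cases exhaust the robber's
  options.\<close>

lemma rwI:
  assumes "cw p q r (vx d j x)"
    and right: "row d x j \<notin> {p, q, r} \<Longrightarrow> cw p q r (vx d (j + 1) x)"
    and left: "row d x (j - 1) \<notin> {p, q, r} \<Longrightarrow> cw p q r (vx d (j - 1) x)"
    and other: "rung d j \<notin> {p, q, r} \<Longrightarrow> cw p q r (vx d j (\<not> x))"
  shows "rw p q r (vx d j x)"
proof -
  have "cw p q r v'" if "robber_move (track k) 3 (tri p q r) (vx d j x) v'" for v'
  proof (cases "v' = vx d j x")
    case False
    let ?e = "{vx d j x, v'}"
    from False that have e: "?e \<in> edges (track k)" "?e \<notin> {p, q, r}"
      by (simp_all add: robber_move_def occupied_tri)
    then have "?e \<in> incident_edges (track k) (vx d j x)" by (simp add: incident_edges_def)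
    then consider "?e = row d x (j - 1)" | "?e = row d x j" | "?e = rung d j"
      by (auto simp: incident_edges_vx)
    then show ?thesis
    proof cases
      case 1
      with False have "v' = vx d (j - 1) x" by (auto simp: row_def doubleton_eq_iff)
      with left e(2) 1 show ?thesis by simp
    next
      case 2
      with False have "v' = vx d (j + 1) x" by (auto simp: row_def doubleton_eq_iff)
      with right e(2) 2 show ?thesis by simp
    next
      case 3
      with False have "v' = vx d j (\<not> x)" by (cases x) (auto simp: rung_def doubleton_eq_iff)
      with other e(2) 3 show ?thesis by simp
    qed
  qed (use assms(1) in simp)
  then show ?thesis by (simp add: rw_def)
qed

lemma near_row [simp]: "j = i \<or> j = i + 1 \<or> j = i - 1 \<Longrightarrow> near (row d x i) (row d x j)"
  by (auto simp: near_def) (auto simp: row_def)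

lemma near_row_rung [simp]: "j = i \<or> j = i + 1 \<Longrightarrow> near (row d x i) (rung d j)"
  by (cases x) (auto simp: near_def, auto simp: row_def rung_def)

lemma near_rung_row [simp]: "j = i \<or> j = i + 1 \<Longrightarrow> near (rung d j) (row d x i)"
  by (cases x) (auto simp: near_def, auto simp: row_def rung_def)

lemma near_rung [simp]: "near (rung d i) (rung d i)"
  by (auto simp: near_def) (auto simp: rung_def)

section \<open>Closing in on the robber\<close>

text \<open>The edge to the right is blocked. After each of the three remaining options the cops
  reach all edges at the robber's vertex in a single turn.\<close>

lemma rw_diagonal: "rw (rung d (j - 1)) (row d x j) (row d (\<not> x) (j - 1)) (vx d j x)"
proof (rule rwI)
  show "cw (rung d (j - 1)) (row d x j) (row d (\<not> x) (j - 1)) (vx d j x)"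
    by (rule cwI[where p' = "row d x (j - 1)" and q' = "row d x j" and r' = "rung d j"])
      (simp_all add: rw_containedI)
  show "cw (rung d (j - 1)) (row d x j) (row d (\<not> x) (j - 1)) (vx d (j - 1) x)"
    by (rule cwI[where p' = "row d x (j - 2)" and q' = "row d x (j - 1)" and r' = "rung d (j - 1)"])
      (simp_all add: rw_containedI)
  show "cw (rung d (j - 1)) (row d x j) (row d (\<not> x) (j - 1)) (vx d j (\<not> x))"
    by (rule cwI[where p' = "row d (\<not> x) (j - 1)" and q' = "rung d j" and r' = "row d (\<not> x) j"])
      (simp_all add: rw_containedI)
qed simp

text \<open>Again the right is blocked. Staying or going left loses at once; crossing the rung leads
  to \<open>rw_diagonal\<close> in the other row.\<close>

lemma rw_bracket: "rw (row d x (j - 2)) (row d (\<not> x) (j - 1)) (row d x j) (vx d j x)"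
proof (rule rwI)
  show "cw (row d x (j - 2)) (row d (\<not> x) (j - 1)) (row d x j) (vx d j x)"
    by (rule cwI[where p' = "row d x (j - 1)" and q' = "rung d j" and r' = "row d x j"])
      (simp_all add: rw_containedI)
  show "cw (row d x (j - 2)) (row d (\<not> x) (j - 1)) (row d x j) (vx d (j - 1) x)"
    by (rule cwI[where p' = "row d x (j - 2)" and q' = "rung d (j - 1)" and r' = "row d x (j - 1)"])
      (simp_all add: rw_containedI)
  show "cw (row d x (j - 2)) (row d (\<not> x) (j - 1)) (row d x j) (vx d j (\<not> x))"
    by (rule cwI[where p' = "rung d (j - 1)" and q' = "row d (\<not> x) j" and r' = "row d x (j - 1)"])
      (use rw_diagonal[of d j "\<not> x"] in simp_all)
qed simp

text \<open>The robber has just run one column to the right; the outer cops enter his row and the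
  middle cop the other one, which is the bracket around column \<open>j + 1\<close>.\<close>

lemma cw_three_rungs_step:
  "cw (rung d (j - 1)) (rung d j) (rung d (j + 1)) (vx d (j + 1) x)"
  by (rule cwI[where p' = "row d x (j - 1)" and q' = "row d (\<not> x) j" and r' = "row d x (j + 1)"])
    (use rw_bracket[of d x "j + 1"] in simp_all)

lemma rw_three_rungs: "rw (rung d (j - 1)) (rung d j) (rung d (j + 1)) (vx d j x)"
proof (rule rwI)
  show "cw (rung d (j - 1)) (rung d j) (rung d (j + 1)) (vx d j x)"
    by (rule cwI[where p' = "row d x (j - 1)" and q' = "rung d j" and r' = "row d x j"])
      (simp_all add: rw_containedI)
  show "cw (rung d (j - 1)) (rung d j) (rung d (j + 1)) (vx d (j + 1) x)"
    by (rule cw_three_rungs_step)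
  show "cw (rung d (j - 1)) (rung d j) (rung d (j + 1)) (vx d (j - 1) x)"
    \<comment> \<open>Running left is running right in the opposite orientation.\<close>
    by (rule cw_swap_outer)
      (use cw_three_rungs_step[of "\<not> d" "- j" x] in \<open>simp add: vx_flip rung_flip add.commute\<close>)
qed simp

section \<open>Heights of the outer cops and the shrinking gap\<close>

text \<open>Heights are doubled midpoints: row edges have odd and rungs have even height. The height of
  an edge is determined only modulo \<open>2 * k\<close>, so the same cop may be regarded as standing on the left
  and on the right of the robber.\<close>

definition cop_at :: "bool \<Rightarrow> (nat \<times> nat) set \<Rightarrow> int \<Rightarrow> bool" where
  "cop_at d e h \<longleftrightarrow> (\<exists>i. e = rung d i \<and> h = 2 * i) \<or> (\<exists>y i. e = row d y i \<and> h = 2 * i + 1)"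

lemma cop_at_row: "cop_at d (row d y i) (2 * i + 1)"
  by (auto simp: cop_at_def)

lemma cop_at_rung: "cop_at d (rung d i) (2 * i)"
  by (auto simp: cop_at_def)

lemma cop_at_oddE:
  assumes "cop_at d e h" "odd h"
  obtains y i where "e = row d y i" "h = 2 * i + 1"
  using assms by (auto simp: cop_at_def)

lemma cop_at_evenE:
  assumes "cop_at d e h" "even h"
  obtains i where "e = rung d i" "h = 2 * i"
  using assms by (auto simp: cop_at_def)

lemma cop_at_near: "cop_at d e h \<Longrightarrow> near e e"
  by (auto simp: cop_at_def)

lemma cop_at_flip: "cop_at d e h \<Longrightarrow> cop_at (\<not> d) e (- h)"
  unfolding cop_at_def
proof (elim disjE exE conjE)
  fix i assume "e = rung d i" "h = 2 * i"
  then show "(\<exists>i. e = rung (\<not> d) i \<and> - h = 2 * i) \<or> (\<exists>y i. e = row (\<not> d) y i \<and> - h = 2 * i + 1)"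
    by (intro disjI1 exI[of _ "- i"]) (simp add: rung_flip)
next
  fix y i assume "e = row d y i" "h = 2 * i + 1"
  then show "(\<exists>i. e = rung (\<not> d) i \<and> - h = 2 * i) \<or> (\<exists>y i. e = row (\<not> d) y i \<and> - h = 2 * i + 1)"
    by (intro disjI2 exI[of _ y] exI[of _ "- i - 1"]) (simp add: row_flip)
qed

text \<open>Only a cop on a row edge can gain 2, by following her row; from a rung one move changes
  the height by at most 1.\<close>

lemma cop_at_up:
  assumes "cop_at d e h" "odd h"
  obtains e' where "near e e'" "cop_at d e' (h + 2)"
proof -
  obtain y i where "e = row d y i" "h = 2 * i + 1" using assms by (rule cop_at_oddE)
  then show thesis using cop_at_row[of d y "i + 1"] that[of "row d y (i + 1)"] by simp
qed

lemma cop_at_down: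
  assumes "cop_at d e h" "odd h"
  obtains e' where "near e e'" "cop_at d e' (h - 2)"
proof -
  obtain y i where "e = row d y i" "h = 2 * i + 1" using assms by (rule cop_at_oddE)
  then show thesis using cop_at_row[of d y "i - 1"] that[of "row d y (i - 1)"] by simp
qed

lemma cop_at_near_rung:
  assumes "cop_at d e h" "\<bar>h - 2 * i\<bar> \<le> 1"
  shows "near e (rung d i)"
proof (cases "even h")
  case True
  then obtain i' where "e = rung d i'" "h = 2 * i'" by (rule cop_at_evenE[OF assms(1)])
  moreover from this have "i' = i" using assms(2) by linarith
  ultimately show ?thesis by simp
next
  case False
  then obtain y i' where "e = row d y i'" "h = 2 * i' + 1" by (rule cop_at_oddE[OF assms(1)])
  moreover from this have "i = i' \<or> i = i' + 1" using assms(2) by linarith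
  ultimately show ?thesis by simp
qed

text \<open>In both kinds of position the outer cops \<open>L\<close> and \<open>R\<close> enclose the robber, who is in column
  \<open>j\<close>, at heights \<open>a\<close> and \<open>b\<close>. The middle cop is on the robber's rung in the first kind; in the
  second kind she is on the edge through which he has just come, moving upwards in row \<open>x\<close>.\<close>

definition shadowed where
  "shadowed d j L R a b \<longleftrightarrow> cop_at d L a \<and> cop_at d R b \<and>
     a \<le> 2 * j - 2 \<and> (even a \<longrightarrow> a = 2 * j - 2) \<and> 2 * j + 2 \<le> b \<and> (even b \<longrightarrow> b = 2 * j + 2)"

definition chased where
  "chased d x j L R a b \<longleftrightarrow> cop_at d L a \<and> cop_at d R b \<and> a \<le> 2 * j - 3 \<and> odd a \<and>
     (R = row d x j \<and> b = 2 * j + 1 \<or> 2 * j + 2 \<le> b \<and> (even b \<longrightarrow> b = 2 * j + 2))"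

lemma shadowed_flip: "shadowed d j L R a b \<Longrightarrow> shadowed (\<not> d) (- j) R L (- b) (- a)"
  by (auto simp: shadowed_def cop_at_flip)

text \<open>The robber rests in column \<open>j\<close> and the middle cop takes his rung. If both
  outer cops reach the neighbouring rungs, \<open>rw_three_rungs\<close> applies. Otherwise a
  distant one has odd height, by the parity conditions, and gains 2, while the other loses at most
  1.\<close>

lemma cw_to_shadowed:
  assumes L: "cop_at d L a" "a \<le> 2 * j - 2" "even a \<longrightarrow> a = 2 * j - 2"
    and R: "cop_at d R b" "2 * j + 1 \<le> b" "even b \<longrightarrow> b = 2 * j + 2"
    and M: "near M (rung d j)"
    and win: "\<And>L' R' a' b'. \<lbrakk>shadowed d j L' R' a' b'; b' - a' < b - a\<rbrakk>
      \<Longrightarrow> rw L' (rung d j) R' (vx d j x)"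
  shows "cw L M R (vx d j x)"
proof -
  let ?l = "rung d (j - 1)" and ?r = "rung d (j + 1)"
  have l: "near L ?l" if "2 * j - 3 \<le> a" using L that by (intro cop_at_near_rung[OF L(1)]) auto
  have r: "near R ?r" if "b \<le> 2 * j + 3" using R that by (intro cop_at_near_rung[OF R(1)]) auto
  have at: "cop_at d ?l (2 * j - 2)" "cop_at d ?r (2 * j + 2)"
    using cop_at_rung[of d "j - 1"] cop_at_rung[of d "j + 1"] by simp_all
  consider "2 * j - 3 \<le> a" "b \<le> 2 * j + 3" | "a < 2 * j - 3" | "2 * j - 3 \<le> a" "b > 2 * j + 3"
    by linarith
  then show ?thesis
  proof cases
    case 1
    then show ?thesis using l r M rw_three_rungs by (intro cwI)
  next
    case 2
    then have "odd a" using L by auto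
    then obtain L' where L': "near L L'" "cop_at d L' (a + 2)" by (rule cop_at_up[OF L(1)])
    \<comment> \<open>The loss of 1 occurs for \<open>b = 2 * j + 1\<close>, where the cop steps
      outward to the rung of column \<open>j + 1\<close>.\<close>
    obtain R' b' where R': "near R R'" "cop_at d R' b'" "2 * j + 2 \<le> b'" "even b' \<longrightarrow> b' = 2 * j + 2"
      "b' \<le> b + 1"
    proof (cases "b \<le> 2 * j + 3")
      case True
      then show thesis using that[OF r at(2)] R by simp
    next
      case False
      then show thesis using that[OF cop_at_near[OF R(1)] R(1)] R by simp
    qed
    have "shadowed d j L' R' (a + 2) b'"
      using L' R' 2 \<open>odd a\<close> by (simp add: shadowed_def)
    then show ?thesis by (rule cwI[OF L'(1) M R'(1) win]) (use R' in simp)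
  next
    case 3
    then have "odd b" using R by auto
    then obtain R' where R': "near R R'" "cop_at d R' (b - 2)" by (rule cop_at_down[OF R(1)])
    have "shadowed d j ?l R' (2 * j - 2) (b - 2)"
      using R' at 3 \<open>odd b\<close> by (auto simp: shadowed_def elim: oddE)
    then show ?thesis by (rule cwI[OF l[OF 3(1)] M R'(1) win]) (use 3 L in auto)
  qed
qed

text \<open>The robber has just run from column \<open>j - 1\<close> to \<open>j\<close>, and the
  middle cop closes the edge behind him. The left cop gains at least 1, and 2 from a row edge; the
  right cop loses at most 1. The left cop ends on a row edge, so a further run makes the gap
  strictly smaller.\<close>

lemma cw_to_chased:
  assumes L: "cop_at d L a" "a \<le> 2 * j - 4" "even a \<longrightarrow> a = 2 * j - 4"
    and R: "cop_at d R b" "2 * j \<le> b" "even b \<longrightarrow> b = 2 * j"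
    and M: "near M (row d x (j - 1))"
    and win: "\<And>L' R' a' b'. \<lbrakk>chased d x j L' R' a' b'; b' - a' \<le> b - a; odd a \<Longrightarrow> b' - a' < b - a\<rbrakk>
      \<Longrightarrow> rw L' (row d x (j - 1)) R' (vx d j x)"
  shows "cw L M R (vx d j x)"
proof -
  obtain L' a' where L': "near L L'" "cop_at d L' a'" "odd a'" "a' \<le> 2 * j - 3"
    "a + 1 \<le> a'" "odd a \<longrightarrow> a + 2 \<le> a'"
  proof (cases "odd a")
    case True
    then obtain e where "near L e" "cop_at d e (a + 2)" by (rule cop_at_up[OF L(1)])
    moreover have "a + 2 \<le> 2 * j - 3" using True L(2) by presburger
    ultimately show thesis using that[of e "a + 2"] True by simp
  next
    case False
    then have "even a" by simp
    then obtain i where "L = rung d i" "a = 2 * i" by (rule cop_at_evenE[OF L(1)])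
    moreover have "a = 2 * j - 4" using False L(3) by simp
    moreover from this have "i = j - 2" using \<open>a = 2 * i\<close> by simp
    ultimately have "L = rung d (j - 2)" "a = 2 * j - 4" by simp_all
    then show thesis
      using that[of "row d x (j - 2)" "2 * j - 3"] cop_at_row[of d x "j - 2"] by simp
  qed
  obtain R' b' where R': "near R R'" "cop_at d R' b'" "b' \<le> b + 1"
    "R' = row d x j \<and> b' = 2 * j + 1 \<or> 2 * j + 2 \<le> b' \<and> (even b' \<longrightarrow> b' = 2 * j + 2)"
  proof -
    \<comment> \<open>From his rung the right cop blocks the edge ahead. At height
      \<open>2 * j + 1\<close> she either blocks it already or is in the other row and retreats to
      the next rung. Farther out she waits.\<close>
    consider "b = 2 * j" | "b = 2 * j + 1" | "2 * j + 2 \<le> b" "odd b" using R by fastforce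
    then show thesis
    proof cases
      case 1
      then have "even b" by simp
      then obtain i where "R = rung d i" "b = 2 * i" by (rule cop_at_evenE[OF R(1)])
      with 1 have "R = rung d j" by simp
      then show thesis using that[of "row d x j"] cop_at_row[of d x j] 1 by simp
    next
      case 2
      then have "odd b" by simp
      then obtain y i where "R = row d y i" "b = 2 * i + 1" by (rule cop_at_oddE[OF R(1)])
      with 2 have "R = row d y j" by simp
      then show thesis
        using that[of "row d x j"] that[of "rung d (j + 1)"] cop_at_row[of d x j]
          cop_at_rung[of d "j + 1"] 2
        by (cases "y = x") auto
    next
      case 3
      then show thesis using that[OF cop_at_near[OF R(1)] R(1)] by simp
    qed
  qed
  have "chased d x j L' R' a' b'" using L' R' by (simp add: chased_def)
  then show ?thesis by (rule cwI[OF L'(1) M R'(1) win]) (use L' R' in auto)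
qed

text \<open>The gap \<open>b - a\<close> never grows. It may stay the same when the robber runs away from a shadowed
  position, and this is the reason for the extra summand in the first measure.\<close>

lemma rw_shadowed_chased:
  "(\<forall>d j x L R a b. shadowed d j L R a b \<longrightarrow> nat (2 * (b - a) + 1) = n \<longrightarrow>
      rw L (rung d j) R (vx d j x)) \<and>
   (\<forall>d j x L R a b. chased d x j L R a b \<longrightarrow> nat (2 * (b - a)) = n \<longrightarrow>
      rw L (row d x (j - 1)) R (vx d j x))"
proof (induction n rule: less_induct)
  case (less n)
  \<comment> \<open>Truncation by \<open>nat\<close> is harmless: in both kinds of position
    \<open>b - a\<close> is at least 4.\<close>
  have shadowed: "rw L (rung d j) R (vx d j x)"
    if "shadowed d j L R a b" "nat (2 * (b - a) + 1) < n" for d j x L R a b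
    using less.IH that by blast
  have chased: "rw L (row d x (j - 1)) R (vx d j x)"
    if "chased d x j L R a b" "nat (2 * (b - a)) < n" for d j x L R a b
    using less.IH that by blast
  have run: "cw L (rung d j) R (vx d (j + 1) x)"
    if s: "shadowed d j L R a b" and n: "nat (2 * (b - a) + 1) = n" for d j x L R a b
  proof (rule cw_to_chased[of d L a "j + 1" R b])
    show "rw L' (row d x (j + 1 - 1)) R' (vx d (j + 1) x)"
      if "chased d x (j + 1) L' R' a' b'" "b' - a' \<le> b - a" for L' R' a' b'
      using that(2) s n by (intro chased[OF that(1)]) (auto simp: shadowed_def)
  qed (use s in \<open>auto simp: shadowed_def\<close>)
  show ?case
  proof (intro conjI allI impI)
    fix d j x L R a b
    assume s: "shadowed d j L R a b" and n: "nat (2 * (b - a) + 1) = n"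
    show "rw L (rung d j) R (vx d j x)"
    proof (rule rwI)
      show "cw L (rung d j) R (vx d j x)"
      proof (rule cw_to_shadowed[of d L a j R b])
        show "rw L' (rung d j) R' (vx d j x)"
          if "shadowed d j L' R' a' b'" "b' - a' < b - a" for L' R' a' b'
          using that(2) s n by (intro shadowed[OF that(1)]) (auto simp: shadowed_def)
      qed (use s in \<open>auto simp: shadowed_def\<close>)
      show "cw L (rung d j) R (vx d (j + 1) x)" by (rule run[OF s n])
      show "cw L (rung d j) R (vx d (j - 1) x)"
        by (rule cw_swap_outer)
          (use run[OF shadowed_flip[OF s], of x] n in \<open>simp add: vx_flip rung_flip add.commute\<close>)
    qed simp
  next
    fix d j x L R a b
    assume c: "chased d x j L R a b" and n: "nat (2 * (b - a)) = n"
    \<comment> \<open>With \<open>y\<close> arbitrary this covers both staying and crossing the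
      rung; the middle cop reaches rung \<open>j\<close> either way.\<close>
    have stay: "cw L (row d x (j - 1)) R (vx d j y)" for y
    proof (rule cw_to_shadowed[of d L a j R b])
      show "rw L' (rung d j) R' (vx d j y)"
        if "shadowed d j L' R' a' b'" "b' - a' < b - a" for L' R' a' b'
        using that(2) c n by (intro shadowed[OF that(1)]) (auto simp: chased_def)
    qed (use c in \<open>auto simp: chased_def\<close>)
    show "rw L (row d x (j - 1)) R (vx d j x)"
    proof (rule rwI)
      assume "row d x j \<notin> {L, row d x (j - 1), R}"
      \<comment> \<open>He runs on only if the edge ahead is free. This leaves
        \<open>2 * j + 2 \<le> b\<close>, the bound required for column
        \<open>j + 1\<close>.\<close>
      then have R: "R \<noteq> row d x j" by blast
      show "cw L (row d x (j - 1)) R (vx d (j + 1) x)"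
      proof (rule cw_to_chased[of d L a "j + 1" R b])
        show "rw L' (row d x (j + 1 - 1)) R' (vx d (j + 1) x)"
          if "chased d x (j + 1) L' R' a' b'" "odd a \<Longrightarrow> b' - a' < b - a" for L' R' a' b'
          using that(2) c n by (intro chased[OF that(1)]) (auto simp: chased_def)
      qed (use c R in \<open>auto simp: chased_def\<close>)
    qed (simp_all add: stay)
  qed
qed

section \<open>The opening sweep\<close>

lemma cw_touched:
  assumes "j = i \<or> j = i + 1"
  shows "cw (row d y g) (row d z i) (row d w h) (vx d j x)"
proof -
  \<comment> \<open>Winding the outer cops \<open>t\<close> times around the track, to the left and
    to the right, puts them on both sides of column \<open>j\<close> wherever they stand. Row edges
    have odd height, so the parity conditions hold.\<close>
  define t where "t = \<bar>g\<bar> + \<bar>h\<bar> + \<bar>j\<bar> + 2"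
  define T where "T = int k * t"
  have "1 * t \<le> T" unfolding T_def using k3 by (intro mult_right_mono) (auto simp: t_def)
  have "row d y (g - T) = row d y g" "row d w (h + T) = row d w h"
    using row_period[of d y g "- t"] row_period[of d w h t] by (simp_all add: T_def)
  moreover have "g - T \<le> j - 2" "j + 1 \<le> h + T"
    using \<open>1 * t \<le> T\<close> by (simp_all add: t_def abs_if split: if_splits)
  ultimately have "shadowed d j (row d y g) (row d w h) (2 * (g - T) + 1) (2 * (h + T) + 1)"
    using cop_at_row[of d y "g - T"] cop_at_row[of d w "h + T"]
    by (simp add: shadowed_def)
  then have "rw (row d y g) (rung d j) (row d w h) (vx d j x)"
    using rw_shadowed_chased by blast
  then show ?thesis by (rule cwI[rotated 3]) (use assms in auto)
qed

text \<open>The middle cop walks along her row while the other two wait on edge 0, which is also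
  edge \<open>k\<close>. The robber is caught between them: he cannot leave the columns from
  \<open>i\<close> to \<open>k + 1\<close> before one of these edges touches his column.\<close>

lemma cw_sweep:
  assumes "i \<le> j" "j \<le> int k + 1"
  shows "cw (row d y 0) (row d y i) (row d y 0) (vx d j x)"
  using assms
proof (induction "nat (int k - i)" arbitrary: i j x rule: less_induct)
  case less
  have "row d y 0 = row d y (int k)" using row_period[of d y 0 1] by simp
  consider "j = i \<or> j = i + 1" | "j = int k \<or> j = int k + 1" | "i + 2 \<le> j" "j < int k"
    using less.prems by linarith
  then show ?case
  proof cases
    case 1
    then show ?thesis by (rule cw_touched)
  next
    case 2
    \<comment> \<open>Now a waiting cop touches his column and becomes the middle cop.\<close>
    then have "cw (row d y 0) (row d y (int k)) (row d y i) (vx d j x)" by (rule cw_touched)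
    then show ?thesis
      using cw_swap_last \<open>row d y 0 = row d y (int k)\<close> by simp
  next
    case 3
    \<comment> \<open>As \<open>i + 2 \<le> j < k\<close>, after the advance to \<open>i + 1\<close>
      any robber move stays between columns \<open>i + 1\<close> and \<open>k\<close>.\<close>
    have "cw (row d y 0) (row d y (i + 1)) (row d y 0) (vx d j' x')"
      if "i + 1 \<le> j'" "j' \<le> int k" for j' x'
      using that 3 by (intro less.hyps) auto
    then have "rw (row d y 0) (row d y (i + 1)) (row d y 0) (vx d j x)"
      using 3 by (intro rwI) auto
    then show ?thesis by (rule cwI[rotated 3]) simp_all
  qed
qed

lemma containable_track: "containable (track k)"
proof -
  let ?e = "row True False 0"
  have "cops_win (track k) 3 (tri ?e ?e ?e) v" if "v \<in> verts (track k)" for v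
  proof -
    from that obtain j x where "0 \<le> j" "j < int k" "v = vx True j x" by (auto simp: verts_vx)
    then show ?thesis using cw_sweep[of 0 j True False x] by (simp add: cw_def)
  qed
  then have "\<exists>\<sigma>. winning_strategy (track k) 3 \<sigma>"
    by (intro winning_strategy_if_cops_win[of _ _ "tri ?e ?e ?e"])
      (simp_all add: cop_placement_def tri_def)
  then show ?thesis
    by (simp add: containable_def simple_graph_track connected_graph_track max_degree_track)
qed

end

theorem proposition3p1:
  fixes k :: nat
  assumes "k \<ge> 3"
  shows "containable (track k)"
  using assms by (intro track_coordinates.containable_track track_coordinates.intro)

end
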